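(* Let $n\ge1$ and let $\lambda$ be a partition with at most $n$ nonzero parts. The non-negative integer valued maps $\mathrm{zcount}$ and $\overline{\mathrm{zcount}}$ on $\mathrm{dg}(\lambda)\times\mathrm{CSF}(\lambda)$ satisfy the following properties: (1) For all $F\in\mathrm{CSF}(\lambda)$: $\sum_{c\in\mathrm{dg}(\lambda)}\mathrm{zcount}(c,F)=\mathrm{quinv}(F)$ and $\sum_{c\in\mathrm{dg}(\lambda)}\overline{\mathrm{zcount}}(c,F)=\mathrm{inv}(F)$. (2) If $F,F'\in\mathrm{CSF}(\lambda)$ with $\mathrm{rsort}(F)=\mathrm{rsort}(F')$, then for all $c\in\mathrm{dg}(\lambda)$: $$\mathrm{zcount}(c,F)+\overline{\mathrm{zcount}}(c,F)=\mathrm{zcount}(c,F')+\overline{\mathrm{zcount}}(c,F').$$ (3) Let $F\in\mathrm{CSF}(\lambda)$ and, for $v\in\{\mathrm{inv},\mathrm{quinv}\}$, let $\mathfrak b_v(F):=\mathrm{CL}(\psi_v(F))$ be the Chari-Loktev monomial of $\psi_v(F)\in\mathrm{POP}(\lambda)$. Then $$\mathfrak b_{\mathrm{quinv}}(F)=\prod_{c}^{\rightharpoonup}E_{F(c),\,i(c)}\otimes t^{\,\mathrm{zcount}(c,F)},\qquad \mathfrak b_{\mathrm{inv}}(F)=\prod_{c}^{\rightharpoonup}E_{F(c),\,i(c)}\otimes t^{\,\overline{\mathrm{zcount}}(c,F)},$$ where $i(c)$ denotes the row number in which $c$ occurs, the products are over the cells $c\in\mathrm{dg}(\lambda)$ with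 $F(c)>i(c)$, and $\prod^{\rightharpoonup}$ means that these cells are enumerated in weakly increasing order of $F(c)$ (any such enumeration gives the same final value in the products).
   Context: The Young diagram of $\lambda$ is $\mathrm{dg}(\lambda)=\{(r,c):1\le c\le\lambda_r\}$, with $r$ the row index from the top and $c$ the column index from the left. $\mathrm{CSF}(\lambda)$ is the set of column strict fillings: maps $F:\mathrm{dg}(\lambda)\to[n]=\{1,\dots,n\}$ strictly increasing down each column. Statistics. For a cell $u=(i,j)$ with $i>1$ let $u^\uparrow=(i-1,j)$; $\mathrm{Des}(F)$ is the set of cells $u$ not in the first row with $F(u)>F(u^\uparrow)$; $\mathrm{arm}(u)$ is the number of cells of $\mathrm{dg}(\lambda)$ strictly to the right of $u$ in its row. A cell $u$ Inv-attacks $v$ if they are in the same row with $u$ strictly left of $v$, or $u$ is in the row immediately below that of $v$, in a column strictly to the right of that of $v$. A cell $u$ Quinv-attacks $v$ if they are in the same row with $u$ strictly right of $v$, or $u$ is in the row immediately below that of $v$, in a column strictly to the left of that of $v$. $\mathrm{Inv}(F)$ (resp. $\mathrm{Quinv}(F)$) is the set of pairs $(u,v)$ such that $u$ Inv-attacks (resp. Quinv-attacks) $v$ and $F(u)>F(v)$. Then $\mathrm{inv}(F)=|\mathrm{Inv}(F)|-\sum_{u\in\mathrm{Des}(F)}\mathrm{arm}(u)$ and $\mathrm{quinv}(F)=|\mathrm{Quinv}(F)|-\sum_{u\in\mathrm{Des}(F)}\mathrm{arm}(u^\uparrow)$. zcounts. For $F\in\mathrm{CSF}(\lambda)$ and a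 cell $c\in\mathrm{dg}(\lambda)$, $\mathrm{zcount}(c,F)$ (resp. $\overline{\mathrm{zcount}}(c,F)$) is the number of cells $x$ in the row of $c$, strictly to the left (resp. strictly to the right) of $c$, such that $F(x)<F(c)<F(y)$, where $y$ is the position immediately below $x$ and $F(y):=\infty$ if $y\notin\mathrm{dg}(\lambda)$. Patterns. $\mathrm{GT}(\lambda)$ is the set of integer arrays $T=(T^j_i:1\le i\le j\le n)$ with $T^n_i=\lambda_i$ and, for $1\le i\le j<n$, $\mathrm{NE}_{ij}(T):=T^{j+1}_i-T^j_i\ge0$ and $\mathrm{SE}_{ij}(T):=T^j_i-T^{j+1}_{i+1}\ge0$; it is identified with semistandard Young tableaux of shape $\lambda$ with entries in $[n]$ by letting $T^j_i$ be the number of cells in row $i$ with entries $\le j$. $\mathrm{rsort}(F)$ is obtained from $F$ by sorting the entries of each row in ascending order from left to right; it is a semistandard tableau, regarded as an element of $\mathrm{GT}(\lambda)$. $\mathrm{POP}(\lambda)$ is the set of pairs $(T,\Lambda)$ with $T\in\mathrm{GT}(\lambda)$ and $\Lambda=(\Lambda_{ij}:1\le i\le j<n)$ a tuple of partitions, $\Lambda_{ij}$ having at most $\mathrm{NE}_{ij}(T)$ nonzero parts, each $\le\mathrm{SE}_{ij}(T)$. The maps $\psi_v:\mathrm{CSF}(\lambda)\to\mathrm{POP}(\lambda)$. For $1\le i\le j<n$ let $\mathrm{cells}(i,j,F)$ be the set of cells $c$ in row $i$ with $F(c)=j+1$. Put $T=\mathrm{rsort}(F)$. Let $\Lambda_{ij}$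 be the sequence of $\mathrm{zcount}(c,F)$, $c\in\mathrm{cells}(i,j,F)$, read from right to left in row $i$, and $\overline\Lambda_{ij}$ the sequence of $\overline{\mathrm{zcount}}(c,F)$, $c\in\mathrm{cells}(i,j,F)$, read from left to right. These are partitions fitting in the $\mathrm{NE}_{ij}(T)\times\mathrm{SE}_{ij}(T)$ rectangle; $\psi_{\mathrm{quinv}}(F)=(T,(\Lambda_{ij}))$ and $\psi_{\mathrm{inv}}(F)=(T,(\overline\Lambda_{ij}))$. Chari-Loktev monomials. Let $\mathfrak n^-$ be the Lie algebra of strictly lower triangular $n\times n$ complex matrices, $E_{pq}$ ($n\ge p>q\ge1$) the elementary matrix with a $1$ in position $(p,q)$, $\mathfrak n^-[t]=\mathfrak n^-\otimes\mathbb C[t]$, and $\mathfrak U\mathfrak n^-[t]$ its universal enveloping algebra. For $\mathfrak P=(T,\Lambda)\in\mathrm{POP}(\lambda)$ and $1\le i\le j<n$, write $\Lambda_{ij}=(\Lambda_{ij}(1)\ge\dots\ge\Lambda_{ij}(k)\ge0)$ with $k=\mathrm{NE}_{ij}(T)$ (zero parts included), and set $\mathbb L_{ij}(\mathfrak P)=\prod_{m=1}^{k}(E_{j+1,i}\otimes t^{\Lambda_{ij}(m)})$, $\mathbb L_j(\mathfrak P)=\prod_{i=1}^j\mathbb L_{ij}(\mathfrak P)$ (in these products the factors commute), and $\mathrm{CL}(\mathfrak P)=\mathbb L_1(\mathfrak P)\mathbb L_2(\mathfrak P)\cdots\mathbb L_{n-1}(\mathfrak P)\in\mathfrak U\mathfrak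 n^-[t]$.
   Formalization: Part (2) fails for the same cell c (n=2, λ=(2), F=(1 2), F'=(2 1), c=(1,1): 0 versus 1); it is proved instead for cells c of F and c' of F' in the same row with F(c)=F'(c'). *)

theory Defs
  imports
    "HOL-Library.FuncSet"
    "HOL-Library.Extended_Nat"
    "HOL-Library.Poly_Mapping"
    "HOL-Computational_Algebra.Polynomial"
    "HOL-Algebra.QuotRing"
    "Jordan_Normal_Form.Matrix"
begin

section \<open>Partitions, diagrams and fillings\<close>

text \<open>
  A partition is the sequence of its parts, indexed from 1 and padded by zeros. Index 0 carries
  no part and is normalised to 0, so that a partition has exactly one representation.
\<close>

definition is_partition :: "(nat \<Rightarrow> nat) \<Rightarrow> bool" where
  "is_partition p \<longleftrightarrow>
     p 0 = 0 \<and> (\<forall>i j. 1 \<le> i \<and> i \<le> j \<longrightarrow> p j \<le> p i) \<and> finite {i. p i \<noteq> 0}"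

definition num_parts :: "(nat \<Rightarrow> nat) \<Rightarrow> nat" where
  "num_parts p = card {i. p i \<noteq> 0}"

definition partition_of_list :: "nat list \<Rightarrow> nat \<Rightarrow> nat" where
  "partition_of_list xs m = (if 1 \<le> m \<and> m \<le> length xs then xs ! (m - 1) else 0)"

text \<open>A cell is a pair (row, column), both counted from 1.\<close>

type_synonym cell = "nat \<times> nat"

definition dg :: "(nat \<Rightarrow> nat) \<Rightarrow> cell set" where
  "dg lam = {(r, c). 1 \<le> r \<and> 1 \<le> c \<and> c \<le> lam r}"

definition up :: "cell \<Rightarrow> cell" where
  "up u = (fst u - 1, snd u)"

definition down :: "cell \<Rightarrow> cell" where
  "down u = (fst u + 1, snd u)"

text \<open>
  A filling is extensional (arbitrary but fixed outside the diagram), so that equality of fillings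
  is equality on the diagram.
\<close>

definition CSF :: "nat \<Rightarrow> (nat \<Rightarrow> nat) \<Rightarrow> (cell \<Rightarrow> nat) set" where
  "CSF n lam = {F \<in> dg lam \<rightarrow>\<^sub>E {1..n}.
     \<forall>u. u \<in> dg lam \<and> down u \<in> dg lam \<longrightarrow> F u < F (down u)}"


section \<open>Statistics\<close>

definition Des :: "(nat \<Rightarrow> nat) \<Rightarrow> (cell \<Rightarrow> nat) \<Rightarrow> cell set" where
  "Des lam F = {u \<in> dg lam. fst u > 1 \<and> F u > F (up u)}"

definition arm :: "(nat \<Rightarrow> nat) \<Rightarrow> cell \<Rightarrow> nat" where
  "arm lam u = card {v \<in> dg lam. fst v = fst u \<and> snd u < snd v}"

definition Inv_attacks :: "cell \<Rightarrow> cell \<Rightarrow> bool" where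
  "Inv_attacks u v \<longleftrightarrow>
     (fst u = fst v \<and> snd u < snd v) \<or> (fst u = fst v + 1 \<and> snd v < snd u)"

definition Quinv_attacks :: "cell \<Rightarrow> cell \<Rightarrow> bool" where
  "Quinv_attacks u v \<longleftrightarrow>
     (fst u = fst v \<and> snd v < snd u) \<or> (fst u = fst v + 1 \<and> snd u < snd v)"

definition Inv_set :: "(nat \<Rightarrow> nat) \<Rightarrow> (cell \<Rightarrow> nat) \<Rightarrow> (cell \<times> cell) set" where
  "Inv_set lam F = {(u, v) \<in> dg lam \<times> dg lam. Inv_attacks u v \<and> F u > F v}"

definition Quinv_set :: "(nat \<Rightarrow> nat) \<Rightarrow> (cell \<Rightarrow> nat) \<Rightarrow> (cell \<times> cell) set" where
  "Quinv_set lam F = {(u, v) \<in> dg lam \<times> dg lam. Quinv_attacks u v \<and> F u > F v}"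

definition inv_stat :: "(nat \<Rightarrow> nat) \<Rightarrow> (cell \<Rightarrow> nat) \<Rightarrow> int" where
  "inv_stat lam F = int (card (Inv_set lam F)) - (\<Sum>u\<in>Des lam F. int (arm lam u))"

definition quinv_stat :: "(nat \<Rightarrow> nat) \<Rightarrow> (cell \<Rightarrow> nat) \<Rightarrow> int" where
  "quinv_stat lam F = int (card (Quinv_set lam F)) - (\<Sum>u\<in>Des lam F. int (arm lam (up u)))"

definition entry :: "(nat \<Rightarrow> nat) \<Rightarrow> (cell \<Rightarrow> nat) \<Rightarrow> cell \<Rightarrow> enat" where
  "entry lam F u = (if u \<in> dg lam then enat (F u) else \<infinity>)"

definition zcount :: "(nat \<Rightarrow> nat) \<Rightarrow> cell \<Rightarrow> (cell \<Rightarrow> nat) \<Rightarrow> nat" where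
  "zcount lam c F = card {x \<in> dg lam. fst x = fst c \<and> snd x < snd c \<and>
     F x < F c \<and> enat (F c) < entry lam F (down x)}"

definition zcount_bar :: "(nat \<Rightarrow> nat) \<Rightarrow> cell \<Rightarrow> (cell \<Rightarrow> nat) \<Rightarrow> nat" where
  "zcount_bar lam c F = card {x \<in> dg lam. fst x = fst c \<and> snd c < snd x \<and>
     F x < F c \<and> enat (F c) < entry lam F (down x)}"


section \<open>Gelfand-Tsetlin patterns and partition overlaid patterns\<close>

text \<open>
  The entry with upper index j and lower index i of a pattern T is written T j i. Arrays and tuples
  are functions that vanish outside their index range.
\<close>

definition NE :: "(nat \<Rightarrow> nat \<Rightarrow> int) \<Rightarrow> nat \<Rightarrow> nat \<Rightarrow> int" where
  "NE T i j = T (j + 1) i - T j i"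

definition SE :: "(nat \<Rightarrow> nat \<Rightarrow> int) \<Rightarrow> nat \<Rightarrow> nat \<Rightarrow> int" where
  "SE T i j = T j i - T (j + 1) (i + 1)"

definition GT :: "nat \<Rightarrow> (nat \<Rightarrow> nat) \<Rightarrow> (nat \<Rightarrow> nat \<Rightarrow> int) set" where
  "GT n lam = {T.
     (\<forall>i. 1 \<le> i \<and> i \<le> n \<longrightarrow> T n i = int (lam i)) \<and>
     (\<forall>i j. 1 \<le> i \<and> i \<le> j \<and> j < n \<longrightarrow> NE T i j \<ge> 0 \<and> SE T i j \<ge> 0) \<and>
     (\<forall>i j. \<not> (1 \<le> i \<and> i \<le> j \<and> j \<le> n) \<longrightarrow> T j i = 0)}"

definition POP :: "nat \<Rightarrow> (nat \<Rightarrow> nat) \<Rightarrow>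
    ((nat \<Rightarrow> nat \<Rightarrow> int) \<times> (nat \<Rightarrow> nat \<Rightarrow> nat \<Rightarrow> nat)) set" where
  "POP n lam = {(T, Lam). T \<in> GT n lam \<and>
     (\<forall>i j. 1 \<le> i \<and> i \<le> j \<and> j < n \<longrightarrow>
        is_partition (Lam i j) \<and> int (num_parts (Lam i j)) \<le> NE T i j \<and>
        (\<forall>m. int (Lam i j m) \<le> SE T i j)) \<and>
     (\<forall>i j. \<not> (1 \<le> i \<and> i \<le> j \<and> j < n) \<longrightarrow> Lam i j = (\<lambda>_. 0))}"

definition rsort :: "(nat \<Rightarrow> nat) \<Rightarrow> (cell \<Rightarrow> nat) \<Rightarrow> cell \<Rightarrow> nat" where
  "rsort lam F = restrict
     (\<lambda>(i, k). sort (map (\<lambda>l. F (i, l)) [1..<lam i + 1]) ! (k - 1)) (dg lam)"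

definition pattern_of :: "nat \<Rightarrow> (nat \<Rightarrow> nat) \<Rightarrow> (cell \<Rightarrow> nat) \<Rightarrow> nat \<Rightarrow> nat \<Rightarrow> int" where
  "pattern_of n lam S j i =
     (if 1 \<le> i \<and> i \<le> j \<and> j \<le> n then int (card {u \<in> dg lam. fst u = i \<and> S u \<le> j}) else 0)"

definition cells :: "(nat \<Rightarrow> nat) \<Rightarrow> nat \<Rightarrow> nat \<Rightarrow> (cell \<Rightarrow> nat) \<Rightarrow> cell set" where
  "cells lam i j F = {c \<in> dg lam. fst c = i \<and> F c = j + 1}"

definition cells_left_to_right ::
    "(nat \<Rightarrow> nat) \<Rightarrow> nat \<Rightarrow> nat \<Rightarrow> (cell \<Rightarrow> nat) \<Rightarrow> cell list" where
  "cells_left_to_right lam i j F = map (Pair i) (sorted_list_of_set (snd ` cells lam i j F))"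

definition psi_quinv :: "nat \<Rightarrow> (nat \<Rightarrow> nat) \<Rightarrow> (cell \<Rightarrow> nat) \<Rightarrow>
    (nat \<Rightarrow> nat \<Rightarrow> int) \<times> (nat \<Rightarrow> nat \<Rightarrow> nat \<Rightarrow> nat)" where
  "psi_quinv n lam F =
     (pattern_of n lam (rsort lam F),
      \<lambda>i j. if 1 \<le> i \<and> i \<le> j \<and> j < n
            then partition_of_list
                   (map (\<lambda>c. zcount lam c F) (rev (cells_left_to_right lam i j F)))
            else (\<lambda>_. 0))"

definition psi_inv :: "nat \<Rightarrow> (nat \<Rightarrow> nat) \<Rightarrow> (cell \<Rightarrow> nat) \<Rightarrow>
    (nat \<Rightarrow> nat \<Rightarrow> int) \<times> (nat \<Rightarrow> nat \<Rightarrow> nat \<Rightarrow> nat)" where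
  "psi_inv n lam F =
     (pattern_of n lam (rsort lam F),
      \<lambda>i j. if 1 \<le> i \<and> i \<le> j \<and> j < n
            then partition_of_list
                   (map (\<lambda>c. zcount_bar lam c F) (cells_left_to_right lam i j F))
            else (\<lambda>_. 0))"


section \<open>Universal enveloping algebras\<close>

text \<open>
  The free associative complex algebra on a set is the monoid algebra of the free monoid, that is,
  finitely supported complex functions on words with the convolution product.
\<close>

datatype 'a free_monoid = Word (letters: "'a list")

instantiation free_monoid :: (type) monoid_add
begin

definition zero_free_monoid :: "'a free_monoid" where
  "zero_free_monoid = Word []"

definition plus_free_monoid :: "'a free_monoid \<Rightarrow> 'a free_monoid \<Rightarrow> 'a free_monoid" where
  "plus_free_monoid v w = Word (letters v @ letters w)"

instance
  by standard (simp_all add: zero_free_monoid_def plus_free_monoid_def)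

end

definition free_algebra :: "'a set \<Rightarrow> ('a free_monoid \<Rightarrow>\<^sub>0 complex) ring" where
  "free_algebra X =
     \<lparr>carrier = {p. \<forall>w\<in>Poly_Mapping.keys p. set (letters w) \<subseteq> X},
      mult = (*), one = 1, zero = 0, add = (+)\<rparr>"

definition gen :: "'a \<Rightarrow> 'a free_monoid \<Rightarrow>\<^sub>0 complex" where
  "gen x = Poly_Mapping.single (Word [x]) 1"

definition scalar :: "complex \<Rightarrow> 'a free_monoid \<Rightarrow>\<^sub>0 complex" where
  "scalar a = Poly_Mapping.single 0 a"

record 'a lie_algebra =
  lie_carrier :: "'a set"
  lie_add :: "'a \<Rightarrow> 'a \<Rightarrow> 'a"
  lie_scale :: "complex \<Rightarrow> 'a \<Rightarrow> 'a"
  lie_bracket :: "'a \<Rightarrow> 'a \<Rightarrow> 'a"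

text \<open>
  The first two families of relations turn the free algebra on the underlying set of L into the
  tensor algebra of the vector space L.
\<close>

definition uea_relations :: "'a lie_algebra \<Rightarrow> ('a free_monoid \<Rightarrow>\<^sub>0 complex) set" where
  "uea_relations L =
     {gen (lie_add L x y) - (gen x + gen y) | x y. x \<in> lie_carrier L \<and> y \<in> lie_carrier L} \<union>
     {gen (lie_scale L a x) - scalar a * gen x | a x. x \<in> lie_carrier L} \<union>
     {gen x * gen y - gen y * gen x - gen (lie_bracket L x y) | x y.
        x \<in> lie_carrier L \<and> y \<in> lie_carrier L}"

definition uea_ideal :: "'a lie_algebra \<Rightarrow> ('a free_monoid \<Rightarrow>\<^sub>0 complex) set" where
  "uea_ideal L = genideal (free_algebra (lie_carrier L)) (uea_relations L)"

definition uea :: "'a lie_algebra \<Rightarrow> ('a free_monoid \<Rightarrow>\<^sub>0 complex) set ring" where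
  "uea L = free_algebra (lie_carrier L) Quot uea_ideal L"

definition uea_embed :: "'a lie_algebra \<Rightarrow> 'a \<Rightarrow> ('a free_monoid \<Rightarrow>\<^sub>0 complex) set" where
  "uea_embed L x = a_r_coset (free_algebra (lie_carrier L)) (uea_ideal L) (gen x)"

definition list_prod :: "('a, 'b) ring_scheme \<Rightarrow> 'a list \<Rightarrow> 'a" where
  "list_prod R xs = foldr (mult R) xs (one R)"


section \<open>Chari-Loktev monomials\<close>

text \<open>
  The tensor product of n-by-n complex matrices with the polynomial ring in t is identified with
  matrices over that polynomial ring; a pure tensor is the entrywise product. Matrix
  indices in the library start at 0, whereas p and q in E_mat n p q start at 1.
\<close>

definition E_mat :: "nat \<Rightarrow> nat \<Rightarrow> nat \<Rightarrow> complex mat" where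
  "E_mat n p q = mat n n (\<lambda>(i, j). if i + 1 = p \<and> j + 1 = q then 1 else 0)"

definition tensor_poly :: "complex mat \<Rightarrow> complex poly \<Rightarrow> complex poly mat" where
  "tensor_poly A f = map_mat (\<lambda>a. Polynomial.smult a f) A"

definition nminus_current :: "nat \<Rightarrow> complex poly mat lie_algebra" where
  "nminus_current n =
     \<lparr>lie_carrier = {A \<in> carrier_mat n n. \<forall>i<n. \<forall>j<n. i \<le> j \<longrightarrow> A $$ (i, j) = 0},
      lie_add = (+),
      lie_scale = (\<lambda>a A. [:a:] \<cdot>\<^sub>m A),
      lie_bracket = (\<lambda>A B. A * B - B * A)\<rparr>"

definition U_nminus :: "nat \<Rightarrow> (complex poly mat free_monoid \<Rightarrow>\<^sub>0 complex) set ring" where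
  "U_nminus n = uea (nminus_current n)"

text \<open>The image in the enveloping algebra of the tensor of E_mat n p q with the r-th power of t.\<close>

definition Et :: "nat \<Rightarrow> nat \<Rightarrow> nat \<Rightarrow> nat \<Rightarrow> (complex poly mat free_monoid \<Rightarrow>\<^sub>0 complex) set"
  where "Et n p q r = uea_embed (nminus_current n) (tensor_poly (E_mat n p q) (monom 1 r))"

definition CL_ij :: "nat \<Rightarrow> (nat \<Rightarrow> nat \<Rightarrow> int) \<times> (nat \<Rightarrow> nat \<Rightarrow> nat \<Rightarrow> nat) \<Rightarrow>
    nat \<Rightarrow> nat \<Rightarrow> (complex poly mat free_monoid \<Rightarrow>\<^sub>0 complex) set" where
  "CL_ij n P i j = list_prod (U_nminus n)
     (map (\<lambda>m. Et n (j + 1) i (snd P i j m)) [1..<nat (NE (fst P) i j) + 1])"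

definition CL_j :: "nat \<Rightarrow> (nat \<Rightarrow> nat \<Rightarrow> int) \<times> (nat \<Rightarrow> nat \<Rightarrow> nat \<Rightarrow> nat) \<Rightarrow>
    nat \<Rightarrow> (complex poly mat free_monoid \<Rightarrow>\<^sub>0 complex) set" where
  "CL_j n P j = list_prod (U_nminus n) (map (\<lambda>i. CL_ij n P i j) [1..<j + 1])"

definition CL :: "nat \<Rightarrow> (nat \<Rightarrow> nat \<Rightarrow> int) \<times> (nat \<Rightarrow> nat \<Rightarrow> nat \<Rightarrow> nat) \<Rightarrow>
    (complex poly mat free_monoid \<Rightarrow>\<^sub>0 complex) set" where
  "CL n P = list_prod (U_nminus n) (map (CL_j n P) [1..<n])"

definition weakly_increasing_enumeration ::
    "(nat \<Rightarrow> nat) \<Rightarrow> (cell \<Rightarrow> nat) \<Rightarrow> cell list \<Rightarrow> bool" where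
  "weakly_increasing_enumeration lam F cs \<longleftrightarrow>
     distinct cs \<and> set cs = {c \<in> dg lam. F c > fst c} \<and> sorted (map F cs)"

end

theory Submission
  imports Defs
begin

text \<open>
  In a column strict filling every cell below the first row is a descent, so the arm sums subtracted
  in quinv and inv count all attacking pairs between consecutive rows. Subtracting them turns the
  inversions between rows into (minus) non-inversions, and moving the lower cell of such a pair one
  step up exhibits them as the pairs excluded from the zcounts. The sum of the two zcounts of a cell
  with entry \<open>j + 1\<close> in row \<open>i\<close> is the number of entries at most \<open>j\<close> in row \<open>i\<close> minus the number of
  entries at most \<open>j + 1\<close> in row \<open>i + 1\<close>, that is \<open>SE\<^sub>i\<^sub>j\<close>; this is invariant under row sorting and
  bounds the parts of the overlaid partitions. In the enveloping algebra \<open>E\<^sub>p\<^sub>q\<close> and \<open>E\<^sub>p\<^sub>r\<close> with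
  \<open>q, r < p\<close> commute, so a product over cells in weakly increasing order of entries does not depend on
  the order among equal entries.
\<close>

subsection \<open>Products of lists in rings\<close>

lemma list_prod_Nil [simp]: "list_prod R [] = \<one>\<^bsub>R\<^esub>"
  and list_prod_Cons [simp]: "list_prod R (x # xs) = x \<otimes>\<^bsub>R\<^esub> list_prod R xs"
  by (simp_all add: list_prod_def)

context ring
begin

lemma list_prod_closed: "set xs \<subseteq> carrier R \<Longrightarrow> list_prod R xs \<in> carrier R"
  by (induction xs) auto

lemma list_prod_append:
  assumes "set xs \<subseteq> carrier R" and "set ys \<subseteq> carrier R"
  shows "list_prod R (xs @ ys) = list_prod R xs \<otimes> list_prod R ys"
  using assms by (induction xs) (auto simp: list_prod_closed m_assoc)

lemma list_prod_concat:
  assumes "\<And>xs. xs \<in> set xss \<Longrightarrow> set xs \<subseteq> carrier R"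
  shows "list_prod R (concat xss) = list_prod R (map (list_prod R) xss)"
  using assms
proof (induction xss)
  case (Cons xs xss)
  then have "set (concat xss) \<subseteq> carrier R"
    by auto
  then show ?case
    using Cons by (simp add: list_prod_append)
qed simp

lemma list_prod_commute:
  assumes "x \<in> carrier R" and "set xs \<subseteq> carrier R" and "\<And>y. y \<in> set xs \<Longrightarrow> x \<otimes> y = y \<otimes> x"
  shows "x \<otimes> list_prod R xs = list_prod R xs \<otimes> x"
  using assms
proof (induction xs)
  case (Cons y ys)
  then have ys: "list_prod R ys \<in> carrier R" and y: "y \<in> carrier R" and x: "x \<in> carrier R"
    by (auto intro: list_prod_closed)
  have "x \<otimes> (y \<otimes> list_prod R ys) = (x \<otimes> y) \<otimes> list_prod R ys"
    using x y ys by (simp add: m_assoc)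
  also have "\<dots> = (y \<otimes> x) \<otimes> list_prod R ys"
    using Cons.prems(3) by simp
  also have "\<dots> = y \<otimes> (list_prod R ys \<otimes> x)"
    using x y ys Cons.IH Cons.prems by (simp add: m_assoc)
  finally show ?case
    using x y ys by (simp add: m_assoc)
qed simp

text \<open>The head \<open>x\<close> of \<open>xs\<close> splits \<open>ys\<close> as
  \<open>as @ x # bs\<close>. Sortedness of both lists forces every element of \<open>as\<close> to
  share the key of \<open>x\<close>, so \<open>g x\<close> moves to the front, and induction applies
  to \<open>as @ bs\<close>.\<close>

lemma list_prod_eq_of_sorted:
  fixes f :: "'i \<Rightarrow> 'k::linorder"
  assumes "mset xs = mset ys" and "sorted (map f xs)" and "sorted (map f ys)"
    and "\<And>x. x \<in> set xs \<Longrightarrow> g x \<in> carrier R"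
    and "\<And>x y. x \<in> set xs \<Longrightarrow> y \<in> set xs \<Longrightarrow> f x = f y \<Longrightarrow> g x \<otimes> g y = g y \<otimes> g x"
  shows "list_prod R (map g xs) = list_prod R (map g ys)"
  using assms
proof (induction xs arbitrary: ys)
  case (Cons x xs)
  have sets: "set ys = insert x (set xs)"
    using mset_eq_setD[OF Cons.prems(1)] by simp
  then obtain as bs where ys: "ys = as @ x # bs"
    using split_list[of x ys] by auto
  have sub: "set as \<subseteq> insert x (set xs)" "set bs \<subseteq> insert x (set xs)"
    using sets ys by auto
  \<comment> \<open>One inequality holds because \<open>y\<close> precedes \<open>x\<close> in
    \<open>ys\<close>, the other because \<open>x\<close> heads \<open>xs\<close>.\<close>
  have same_key: "f y = f x" if "y \<in> set as" for y
  proof (rule antisym)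
    show "f y \<le> f x"
      using Cons.prems(3) that by (auto simp: ys sorted_append)
    show "f x \<le> f y"
      using Cons.prems(2) sub that by auto
  qed
  have gas: "set (map g as) \<subseteq> carrier R" and gbs: "set (map g bs) \<subseteq> carrier R"
    and gx: "g x \<in> carrier R"
    using Cons.prems(4) sub by auto
  have comm: "g x \<otimes> list_prod R (map g as) = list_prod R (map g as) \<otimes> g x"
  proof (rule list_prod_commute[OF gx gas])
    show "g x \<otimes> y = y \<otimes> g x" if "y \<in> set (map g as)" for y
      using that Cons.prems(5) same_key sub by fastforce
  qed
  have "list_prod R (map g xs) = list_prod R (map g (as @ bs))"
  proof (rule Cons.IH)
    show "mset xs = mset (as @ bs)"
      using Cons.prems(1) by (simp add: ys)
    show "sorted (map f xs)" "sorted (map f (as @ bs))"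
      using Cons.prems(2,3) by (auto simp: ys sorted_append)
    show "g x \<in> carrier R" if "x \<in> set xs" for x
      using that Cons.prems(4) by simp
    show "g x \<otimes> g y = g y \<otimes> g x" if "x \<in> set xs" "y \<in> set xs" "f x = f y" for x y
      using that Cons.prems(5) by simp
  qed
  moreover have "list_prod R (map g ys) = list_prod R (map g as) \<otimes> (g x \<otimes> list_prod R (map g bs))"
    using gas gbs gx by (simp add: ys list_prod_append)
  moreover have "\<dots> = g x \<otimes> (list_prod R (map g as) \<otimes> list_prod R (map g bs))"
    using gas gbs gx comm by (metis list_prod_closed m_assoc)
  ultimately show ?case
    using gas gbs by (simp add: list_prod_append)
qed simp

end


subsection \<open>Enveloping algebras\<close>

lemma letters_zero [simp]: "letters 0 = []"
  and letters_plus [simp]: "letters (v + w) = letters v @ letters w"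
  by (simp_all add: zero_free_monoid_def plus_free_monoid_def)

lemma free_algebra_simps [simp]:
  "\<one>\<^bsub>free_algebra X\<^esub> = 1" "\<zero>\<^bsub>free_algebra X\<^esub> = 0"
  "p \<otimes>\<^bsub>free_algebra X\<^esub> q = p * q" "p \<oplus>\<^bsub>free_algebra X\<^esub> q = p + q"
  by (simp_all add: free_algebra_def)

lemma mem_free_algebra_iff:
  "p \<in> carrier (free_algebra X) \<longleftrightarrow> (\<forall>w\<in>Poly_Mapping.keys p. set (letters w) \<subseteq> X)"
  by (simp add: free_algebra_def)

lemma free_algebra_closed:
  assumes "p \<in> carrier (free_algebra X)" and "q \<in> carrier (free_algebra X)"
  shows free_algebra_add_closed: "p + q \<in> carrier (free_algebra X)"
    and free_algebra_diff_closed: "p - q \<in> carrier (free_algebra X)"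
    and free_algebra_mult_closed: "p * q \<in> carrier (free_algebra X)"
    and free_algebra_uminus_closed: "- p \<in> carrier (free_algebra X)"
proof -
  have "Poly_Mapping.keys (p - q) \<subseteq> Poly_Mapping.keys p \<union> Poly_Mapping.keys q"
    by (auto simp: in_keys_iff lookup_minus)
  then show "p - q \<in> carrier (free_algebra X)"
    using assms by (auto simp: mem_free_algebra_iff subset_iff)
  show "p + q \<in> carrier (free_algebra X)"
    using assms keys_add[of p q] by (auto simp: mem_free_algebra_iff subset_iff)
  show "p * q \<in> carrier (free_algebra X)"
    using assms keys_mult[of p q] by (fastforce simp: mem_free_algebra_iff subset_iff)
  have "Poly_Mapping.keys (- p) = Poly_Mapping.keys p"
    by (auto simp: in_keys_iff)
  then show "- p \<in> carrier (free_algebra X)"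
    using assms by (simp add: mem_free_algebra_iff)
qed

lemma free_algebra_ring: "ring (free_algebra X)"
proof (rule ringI)
  show "abelian_group (free_algebra X)"
  proof (rule abelian_groupI)
    show "\<exists>q\<in>carrier (free_algebra X). q \<oplus>\<^bsub>free_algebra X\<^esub> p = \<zero>\<^bsub>free_algebra X\<^esub>"
      if "p \<in> carrier (free_algebra X)" for p
      using free_algebra_uminus_closed[OF that that] by (intro bexI[of _ "- p"]) auto
  qed (auto simp: free_algebra_add_closed algebra_simps mem_free_algebra_iff[of 0])
  show "Group.monoid (free_algebra X)"
    by (rule monoidI) (auto simp: free_algebra_mult_closed algebra_simps mem_free_algebra_iff[of 1])
qed (auto simp: algebra_simps)

lemma gen_mem_free_algebra: "x \<in> X \<Longrightarrow> gen x \<in> carrier (free_algebra X)"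
  by (simp add: mem_free_algebra_iff gen_def)

lemma scalar_mem_free_algebra: "scalar a \<in> carrier (free_algebra X)"
  by (simp add: mem_free_algebra_iff scalar_def)

text \<open>Closure of the three operations places the defining relations inside the free algebra,
  so that they generate an ideal there.\<close>

locale closed_lie_algebra =
  fixes L :: "'a lie_algebra"
  assumes add_closed: "x \<in> lie_carrier L \<Longrightarrow> y \<in> lie_carrier L \<Longrightarrow> lie_add L x y \<in> lie_carrier L"
    and scale_closed: "x \<in> lie_carrier L \<Longrightarrow> lie_scale L a x \<in> lie_carrier L"
    and bracket_closed: "x \<in> lie_carrier L \<Longrightarrow> y \<in> lie_carrier L \<Longrightarrow> lie_bracket L x y \<in> lie_carrier L"
begin

abbreviation "FA \<equiv> free_algebra (lie_carrier L)"

lemma uea_relations_subset: "uea_relations L \<subseteq> carrier FA"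
  unfolding uea_relations_def
  by (auto intro!: free_algebra_diff_closed free_algebra_add_closed free_algebra_mult_closed
      gen_mem_free_algebra scalar_mem_free_algebra add_closed scale_closed bracket_closed)

lemma uea_ideal_ideal: "ideal (uea_ideal L) FA"
  unfolding uea_ideal_def
  by (rule ring.genideal_ideal[OF free_algebra_ring uea_relations_subset])

lemma uea_relations_in_ideal: "uea_relations L \<subseteq> uea_ideal L"
  unfolding uea_ideal_def
  by (rule ring.genideal_self[OF free_algebra_ring uea_relations_subset])

lemma uea_ring: "ring (uea L)"
  unfolding uea_def by (rule ideal.quotient_is_ring[OF uea_ideal_ideal])

lemma uea_hom: "a_r_coset FA (uea_ideal L) \<in> Ring.ring_hom FA (uea L)"
  unfolding uea_def by (rule ideal.rcos_ring_hom[OF uea_ideal_ideal])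

lemma uea_embed_closed: "x \<in> lie_carrier L \<Longrightarrow> uea_embed L x \<in> carrier (uea L)"
  unfolding uea_embed_def using uea_hom gen_mem_free_algebra by (rule ring_hom_closed)

text \<open>The bracket relation makes xy - yx equal to [x,y] in the quotient. As
  \<open>lie_algebra\<close> has no zero field, a vanishing bracket is written as 0 times
  \<open>x\<close>; the scaling relation with factor 0 puts its generator in the ideal.\<close>

lemma uea_embed_commute:
  assumes x: "x \<in> lie_carrier L" and y: "y \<in> lie_carrier L"
    and bracket: "lie_bracket L x y = lie_scale L 0 x"
  shows "uea_embed L x \<otimes>\<^bsub>uea L\<^esub> uea_embed L y = uea_embed L y \<otimes>\<^bsub>uea L\<^esub> uea_embed L x"
proof -
  interpret I: ideal "uea_ideal L" FA
    by (rule uea_ideal_ideal)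
  have gx: "gen x \<in> carrier FA" and gy: "gen y \<in> carrier FA"
    using x y by (auto intro: gen_mem_free_algebra)
  have scalar0: "scalar 0 = 0"
    by (simp add: scalar_def)
  have "gen (lie_scale L 0 x) - scalar 0 * gen x \<in> uea_ideal L"
    using uea_relations_in_ideal x unfolding uea_relations_def by blast
  then have "gen (lie_bracket L x y) \<in> uea_ideal L"
    by (simp add: scalar0 bracket)
  moreover have "gen x * gen y - gen y * gen x - gen (lie_bracket L x y) \<in> uea_ideal L"
    using uea_relations_in_ideal x y unfolding uea_relations_def by blast
  ultimately have "(gen x * gen y - gen y * gen x - gen (lie_bracket L x y)) \<oplus>\<^bsub>FA\<^esub>
      gen (lie_bracket L x y) \<in> uea_ideal L"
    by (rule additive_subgroup.a_closed[OF I.additive_subgroup_axioms, rotated])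
  then have diff: "gen x * gen y - gen y * gen x \<in> uea_ideal L"
    by simp
  then have "a_r_coset FA (uea_ideal L) (gen x * gen y - gen y * gen x) = \<zero>\<^bsub>uea L\<^esub>"
    using I.a_rcos_const[OF diff] by (simp add: uea_def FactRing_def)
  moreover have "gen x * gen y - gen y * gen x \<in> carrier FA" and "gen y * gen x \<in> carrier FA"
    using gx gy by (auto intro!: free_algebra_diff_closed free_algebra_mult_closed)
  ultimately have "a_r_coset FA (uea_ideal L) ((gen x * gen y - gen y * gen x) \<oplus>\<^bsub>FA\<^esub> gen y * gen x) =
      a_r_coset FA (uea_ideal L) (gen y * gen x)"
    using ring_hom_add[OF uea_hom, of "gen x * gen y - gen y * gen x" "gen y * gen x"]
      ring_hom_closed[OF uea_hom, of "gen y * gen x"] ring.ring_simprules(8)[OF uea_ring]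
    by simp
  then have "a_r_coset FA (uea_ideal L) (gen x * gen y) = a_r_coset FA (uea_ideal L) (gen y * gen x)"
    by simp
  then show ?thesis
    using ring_hom_mult[OF uea_hom gx gy] ring_hom_mult[OF uea_hom gy gx]
    by (simp add: uea_embed_def)
qed

end

section \<open>The current algebra of strictly lower triangular matrices\<close>

lemma nminus_current_closed: "closed_lie_algebra (nminus_current n)"
proof
  fix x y assume x: "x \<in> lie_carrier (nminus_current n)" and y: "y \<in> lie_carrier (nminus_current n)"
  show "lie_add (nminus_current n) x y \<in> lie_carrier (nminus_current n)"
    using x y by (auto simp: nminus_current_def)
  show "lie_scale (nminus_current n) a x \<in> lie_carrier (nminus_current n)" for a
    using x by (auto simp: nminus_current_def)
  \<comment> \<open>In each summand either i \<le> k kills the entry of \<open>A\<close>, or k < i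
    \<le> j kills the entry of \<open>B\<close>.\<close>
  have lower: "(A * B) $$ (i, j) = 0"
    if "A \<in> lie_carrier (nminus_current n)" "B \<in> lie_carrier (nminus_current n)"
      "i < n" "j < n" "i \<le> j" for A B i j
  proof -
    have "A $$ (i, k) * B $$ (k, j) = 0" if "k < n" for k
      using that \<open>A \<in> _\<close> \<open>B \<in> _\<close> \<open>i < n\<close> \<open>j < n\<close> \<open>i \<le> j\<close>
      by (cases "i \<le> k") (auto simp: nminus_current_def)
    then show ?thesis
      using that by (auto simp: nminus_current_def scalar_prod_def intro!: sum.neutral)
  qed
  show "lie_bracket (nminus_current n) x y \<in> lie_carrier (nminus_current n)"
    using x y lower[OF x y] lower[OF y x] by (auto simp: nminus_current_def)
qed

text \<open>The Lie algebra element whose image in the enveloping algebra is \<open>Et\<close>;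
  naming it allows matrix computations before passing to cosets.\<close>

definition elem_current :: "nat \<Rightarrow> nat \<Rightarrow> nat \<Rightarrow> nat \<Rightarrow> complex poly mat" where
  "elem_current n p q r = tensor_poly (E_mat n p q) (monom 1 r)"

lemma elem_current_mem: "q < p \<Longrightarrow> elem_current n p q r \<in> lie_carrier (nminus_current n)"
  by (auto simp: elem_current_def tensor_poly_def E_mat_def nminus_current_def)

lemma elem_current_mult_zero:
  assumes "q \<noteq> p'"
  shows "elem_current n p q r * elem_current n p' q' r' = 0\<^sub>m n n"
  using assms
  by (intro eq_matI) (auto simp: elem_current_def tensor_poly_def E_mat_def scalar_prod_def intro!: sum.neutral)

lemma U_nminus_ring: "ring (U_nminus n)"
  unfolding U_nminus_def by (rule closed_lie_algebra.uea_ring[OF nminus_current_closed])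

lemma Et_closed: "q < p \<Longrightarrow> Et n p q r \<in> carrier (U_nminus n)"
  using closed_lie_algebra.uea_embed_closed[OF nminus_current_closed elem_current_mem]
  by (simp add: Et_def U_nminus_def elem_current_def)

text \<open>Since \<open>q\<close> and \<open>q'\<close> both differ from \<open>p\<close>, the two
  matrix products vanish and so does the bracket.\<close>

lemma Et_commute:
  assumes "q < p" and "q' < p"
  shows "Et n p q r \<otimes>\<^bsub>U_nminus n\<^esub> Et n p q' r' = Et n p q' r' \<otimes>\<^bsub>U_nminus n\<^esub> Et n p q r"
proof -
  have carr: "elem_current n p q r \<in> carrier_mat n n"
    by (simp add: elem_current_def tensor_poly_def E_mat_def)
  have "lie_bracket (nminus_current n) (elem_current n p q r) (elem_current n p q' r') =
        lie_scale (nminus_current n) 0 (elem_current n p q r)"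
    using assms carr by (auto simp: nminus_current_def elem_current_mult_zero intro!: eq_matI)
  then show ?thesis
    using closed_lie_algebra.uea_embed_commute[OF nminus_current_closed
        elem_current_mem[OF assms(1)] elem_current_mem[OF assms(2)]]
    by (simp add: Et_def U_nminus_def elem_current_def)
qed


subsection \<open>Zcounts and attack relations\<close>

lemma finite_dg:
  assumes "is_partition lam"
  shows "finite (dg lam)"
proof (rule finite_subset)
  show "dg lam \<subseteq> {i. lam i \<noteq> 0} \<times> {..lam 1}"
  proof clarify
    fix i k assume "(i, k) \<in> dg lam"
    then have "1 \<le> i" "1 \<le> k" "k \<le> lam i"
      by (auto simp: dg_def)
    moreover from \<open>1 \<le> i\<close> have "lam i \<le> lam 1"
      using assms unfolding is_partition_def by blast
    ultimately show "i \<in> {i. lam i \<noteq> 0} \<and> k \<in> {..lam 1}"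
      by auto
  qed
  show "finite ({i. lam i \<noteq> 0} \<times> {..lam 1})"
    using assms by (simp add: is_partition_def)
qed

lemma dg_upward_closed:
  assumes "is_partition lam" and "(Suc i, k) \<in> dg lam" and "1 \<le> i"
  shows "(i, k) \<in> dg lam"
proof -
  have "lam (Suc i) \<le> lam i"
    using assms by (simp add: is_partition_def)
  then show ?thesis
    using assms by (simp add: dg_def)
qed

lemma CSF_less:
  assumes "F \<in> CSF n lam" and "(i, k) \<in> dg lam" and "(Suc i, k) \<in> dg lam"
  shows "F (i, k) < F (Suc i, k)"
  using assms by (fastforce simp: CSF_def down_def)

lemma CSF_range: "F \<in> CSF n lam \<Longrightarrow> c \<in> dg lam \<Longrightarrow> 1 \<le> F c \<and> F c \<le> n"
  unfolding CSF_def using PiE_mem[of F "dg lam" "\<lambda>_. {1..n}" c] by simp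

lemma Des_CSF:
  assumes "is_partition lam" and "F \<in> CSF n lam"
  shows "Des lam F = {u \<in> dg lam. 1 < fst u}"
proof -
  have "F (up u) < F u" if "u \<in> dg lam" "1 < fst u" for u
    using that CSF_less[OF assms(2), of "fst u - 1" "snd u"]
      dg_upward_closed[OF assms(1), of "fst u - 1" "snd u"]
    by (auto simp: up_def)
  then show ?thesis
    by (auto simp: Des_def)
qed

lemma enat_less_entry_iff: "enat k < entry lam F u \<longleftrightarrow> (u \<in> dg lam \<longrightarrow> k < F u)"
  by (simp add: entry_def)

text \<open>
  With R the relation \<open><\<close> on columns this is the count behind quinv, and with \<open>>\<close> the one behind inv.
  The pairs \<open>(x, c)\<close> with \<open>F x < F c\<close> in a row that zcount discards are those with
  \<open>F (down x) \<le> F c\<close>; they biject with the non-inversions between consecutive rows.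
\<close>

lemma sum_zcount_rel:
  assumes part: "is_partition lam" and F: "F \<in> CSF n lam"
  shows "(\<Sum>c\<in>dg lam. int (card {x \<in> dg lam. fst x = fst c \<and> R (snd x) (snd c) \<and>
            F x < F c \<and> enat (F c) < entry lam F (down x)})) =
         int (card {(u, v) \<in> dg lam \<times> dg lam.
            (fst u = fst v \<and> R (snd v) (snd u) \<or> fst u = fst v + 1 \<and> R (snd u) (snd v)) \<and> F u > F v}) -
         int (card {(u, v) \<in> dg lam \<times> dg lam. fst u = fst v + 1 \<and> R (snd u) (snd v)})"
proof -
  define D where "D = dg lam"
  have finD: "finite D" and finDD: "finite (D \<times> D)"
    using finite_dg[OF part] by (simp_all add: D_def)
  define Z where "Z = {(c, x) \<in> D \<times> D. fst x = fst c \<and> R (snd x) (snd c) \<and> F x < F c \<and>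
    enat (F c) < entry lam F (down x)}"
  define S where "S = {(c, x) \<in> D \<times> D. fst c = fst x \<and> R (snd x) (snd c) \<and> F c > F x}"
  define B where "B = {(u, v) \<in> D \<times> D. fst u = fst v + 1 \<and> R (snd u) (snd v) \<and> F u > F v}"
  define P where "P = {(u, v) \<in> D \<times> D. fst u = fst v + 1 \<and> R (snd u) (snd v)}"
  have fin: "finite S" "finite P"
    using finDD by (auto simp: S_def P_def intro: rev_finite_subset)
  have ZS: "Z \<subseteq> S" and BP: "B \<subseteq> P" and SB: "S \<inter> B = {}"
    by (auto simp: Z_def S_def B_def P_def)
  have "bij_betw (\<lambda>(u, v). (v, up u)) (P - B) (S - Z)"
  proof (rule bij_betwI[where g = "\<lambda>(c, x). (down x, c)"])
    show "(\<lambda>(u, v). (v, up u)) \<in> P - B \<rightarrow> S - Z"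
    proof
      fix p assume p: "p \<in> P - B"
      obtain i k l where p_eq: "p = ((Suc i, k), (i, l))"
        using p by (cases p) (auto simp: P_def)
      have mem: "(Suc i, k) \<in> D" "(i, l) \<in> D" "R k l" "F (Suc i, k) \<le> F (i, l)"
        using p by (auto simp: p_eq P_def B_def)
      have "1 \<le> i"
        using mem by (simp add: D_def dg_def)
      \<comment> \<open>Column strictness gives \<open>F (up u) < F u\<close> and
        \<open>F u \<le> F v\<close>, so \<open>(v, up u)\<close> lies in \<open>S\<close>; the
        entry below \<open>up u\<close> is \<open>F u\<close>, which makes it fail the test in
        \<open>Z\<close>.\<close>
      then have "(i, k) \<in> D" "F (i, k) < F (Suc i, k)"
        using mem dg_upward_closed[OF part, of i k] CSF_less[OF F, of i k] by (auto simp: D_def)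
      then show "(\<lambda>(u, v). (v, up u)) p \<in> S - Z"
        using mem by (auto simp: p_eq S_def Z_def up_def down_def enat_less_entry_iff D_def)
    qed
    show "(\<lambda>(c, x). (down x, c)) \<in> S - Z \<rightarrow> P - B"
      by (auto simp: S_def Z_def P_def B_def enat_less_entry_iff D_def down_def)
    show "(\<lambda>(c, x). (down x, c)) ((\<lambda>(u, v). (v, up u)) p) = p" if "p \<in> P - B" for p
      using that by (auto simp: P_def up_def down_def)
    show "(\<lambda>(u, v). (v, up u)) ((\<lambda>(c, x). (down x, c)) q) = q" for q
      by (cases q) (simp add: up_def down_def)
  qed
  \<comment> \<open>The inclusions of \<open>B\<close> in \<open>P\<close> and of \<open>Z\<close>
    in \<open>S\<close> rule out truncated subtraction, so this becomes an identity of
    integers.\<close>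
  then have "card P - card B = card S - card Z"
    using card_Diff_subset[OF _ BP] card_Diff_subset[OF _ ZS] fin ZS BP
    by (simp add: bij_betw_same_card finite_subset)
  moreover have "card Z \<le> card S" "card B \<le> card P"
    using fin ZS BP by (simp_all add: card_mono)
  ultimately have "int (card Z) = int (card S) + int (card B) - int (card P)"
    by linarith
  also have "card S + card B = card (S \<union> B)"
    using card_Un_disjoint[OF _ _ SB] fin BP by (simp add: finite_subset)
  then have "int (card S) + int (card B) = int (card (S \<union> B))"
    by simp
  also have "S \<union> B = {(u, v) \<in> D \<times> D.
      (fst u = fst v \<and> R (snd v) (snd u) \<or> fst u = fst v + 1 \<and> R (snd u) (snd v)) \<and> F u > F v}"
    by (auto simp: S_def B_def)
  finally have card_Z: "int (card Z) = int (card \<dots>) - int (card P)" .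
  have "Z = (SIGMA c:D. {x \<in> D. fst x = fst c \<and> R (snd x) (snd c) \<and>
      F x < F c \<and> enat (F c) < entry lam F (down x)})"
    by (auto simp: Z_def)
  then have "(\<Sum>c\<in>D. int (card {x \<in> D. fst x = fst c \<and> R (snd x) (snd c) \<and>
      F x < F c \<and> enat (F c) < entry lam F (down x)})) = int (card Z)"
    using finD by simp
  from trans[OF this card_Z] show ?thesis
    unfolding D_def P_def .
qed

text \<open>Fixing the lower cell \<open>u\<close> of a pair in consecutive rows, which is a
  descent, leaves for \<open>v\<close> exactly the cells counted by the arm of
  \<open>up u\<close>.\<close>

lemma sum_zcount:
  assumes part: "is_partition lam" and F: "F \<in> CSF n lam"
  shows "(\<Sum>c\<in>dg lam. int (zcount lam c F)) = quinv_stat lam F"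
proof -
  have fin: "finite (dg lam)"
    by (rule finite_dg[OF part])
  let ?P = "{(u, v) \<in> dg lam \<times> dg lam. fst u = fst v + 1 \<and> snd u < snd v}"
  have "?P = (SIGMA u:Des lam F. {v \<in> dg lam. fst v = fst (up u) \<and> snd (up u) < snd v})"
    by (auto simp: Des_CSF[OF part F] up_def dg_def)
  then have "int (card ?P) = (\<Sum>u\<in>Des lam F. int (arm lam (up u)))"
    using fin by (simp add: arm_def Des_def)
  then show ?thesis
    using sum_zcount_rel[OF part F, of "(<)"]
    by (simp only: zcount_def quinv_stat_def Quinv_set_def Quinv_attacks_def)
qed

text \<open>Here the arm belongs to a descent in the lower row, so the upper cell \<open>v\<close>
  is first moved down. Its image stays in the diagram because \<open>u\<close> lies further right in
  that row.\<close>

lemma sum_zcount_bar: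
  assumes part: "is_partition lam" and F: "F \<in> CSF n lam"
  shows "(\<Sum>c\<in>dg lam. int (zcount_bar lam c F)) = inv_stat lam F"
proof -
  have fin: "finite (dg lam)"
    by (rule finite_dg[OF part])
  let ?P = "{(u, v) \<in> dg lam \<times> dg lam. fst u = fst v + 1 \<and> snd u > snd v}"
  let ?Q = "SIGMA w:Des lam F. {u \<in> dg lam. fst u = fst w \<and> snd w < snd u}"
  have "bij_betw (\<lambda>(u, v). (down v, u)) ?P ?Q"
  proof (rule bij_betwI[where g = "\<lambda>(w, u). (u, up w)"])
    show "(\<lambda>(u, v). (down v, u)) \<in> ?P \<rightarrow> ?Q"
      by (auto simp: Des_CSF[OF part F] down_def dg_def)
    show "(\<lambda>(w, u). (u, up w)) \<in> ?Q \<rightarrow> ?P"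
    proof
      fix q assume q: "q \<in> ?Q"
      obtain i k l where q_eq: "q = ((Suc i, k), (Suc i, l))" and "1 \<le> i"
        using q by (cases q) (auto simp: Des_CSF[OF part F] gr0_conv_Suc less_Suc_eq_0_disj
            dest!: less_imp_Suc_add)
      then show "(\<lambda>(w, u). (u, up w)) q \<in> ?P"
        using q dg_upward_closed[OF part, of i k] by (auto simp: Des_def up_def)
    qed
  qed (auto simp: Des_def up_def down_def)
  then have "card ?P = card ?Q"
    by (rule bij_betw_same_card)
  then have "int (card ?P) = (\<Sum>u\<in>Des lam F. int (arm lam u))"
    using fin by (simp add: arm_def Des_def)
  then show ?thesis
    using sum_zcount_rel[OF part F, of "(>)"]
    by (simp only: zcount_bar_def inv_stat_def Inv_set_def Inv_attacks_def)
qed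


subsection \<open>Row counts\<close>

text \<open>The Gelfand-Tsetlin entry as a natural number, without index range and taken from the
  unsorted filling, so that it can be compared before and after sorting.\<close>

definition row_count :: "(nat \<Rightarrow> nat) \<Rightarrow> (cell \<Rightarrow> nat) \<Rightarrow> nat \<Rightarrow> nat \<Rightarrow> nat" where
  "row_count lam F i k = card {u \<in> dg lam. fst u = i \<and> F u \<le> k}"

abbreviation row_list :: "(nat \<Rightarrow> nat) \<Rightarrow> (cell \<Rightarrow> nat) \<Rightarrow> nat \<Rightarrow> nat list" where
  "row_list lam F i \<equiv> map (\<lambda>l. F (i, l)) [1..<lam i + 1]"

text \<open>The list form matches \<open>rsort\<close>, which is defined by sorting lists.\<close>

lemma row_count_row_list:
  assumes "1 \<le> i"
  shows "row_count lam F i k = length (filter (\<lambda>v. v \<le> k) (row_list lam F i))"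
proof -
  have "{u \<in> dg lam. fst u = i \<and> F u \<le> k} = Pair i ` {l \<in> {1..<lam i + 1}. F (i, l) \<le> k}"
    using assms by (auto simp: dg_def)
  then have "row_count lam F i k = card {l \<in> {1..<lam i + 1}. F (i, l) \<le> k}"
    by (simp add: row_count_def card_image inj_on_def)
  also have "\<dots> = card (set (filter (\<lambda>l. F (i, l) \<le> k) [1..<lam i + 1]))"
    by (rule arg_cong[where f = card]) auto
  also have "\<dots> = length (filter (\<lambda>l. F (i, l) \<le> k) [1..<lam i + 1])"
    by (rule distinct_card) simp
  finally show ?thesis
    by (simp add: filter_map comp_def)
qed

lemma row_list_rsort:
  assumes "1 \<le> i"
  shows "row_list lam (rsort lam F) i = sort (row_list lam F i)"
  using assms by (intro nth_equalityI) (auto simp: rsort_def dg_def simp del: upt_Suc)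

lemma row_count_rsort: "row_count lam (rsort lam F) i k = row_count lam F i k"
proof (cases "1 \<le> i")
  case True
  have "length (filter (\<lambda>v. v \<le> k) (sort (row_list lam F i))) =
        length (filter (\<lambda>v. v \<le> k) (row_list lam F i))"
    by (simp add: filter_sort)
  then show ?thesis
    using True by (simp only: row_count_row_list row_list_rsort)
next
  case False
  then have "{u \<in> dg lam. fst u = i \<and> G u \<le> k} = {}" for G :: "cell \<Rightarrow> nat"
    by (auto simp: dg_def)
  then show ?thesis
    by (simp only: row_count_def)
qed

text \<open>
  The cells of row i counted by one of the two zcounts of c are the x with \<open>F x < F c\<close>, except those
  with \<open>F (down x) \<le> F c\<close>, and \<open>down\<close> maps the latter onto the cells of row \<open>i + 1\<close> with
  entries at most \<open>F c\<close>.
\<close>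

lemma zcount_add_zcount_bar:
  assumes part: "is_partition lam" and F: "F \<in> CSF n lam" and c: "c \<in> dg lam"
  shows "zcount lam c F + zcount_bar lam c F + row_count lam F (fst c + 1) (F c) =
         row_count lam F (fst c) (F c - 1)"
proof -
  have fin: "finite (dg lam)"
    by (rule finite_dg[OF part])
  define i where "i = fst c"
  have i: "1 \<le> i"
    using c by (auto simp: i_def dg_def)
  define Y where "Y = {y \<in> dg lam. fst y = i + 1 \<and> F y \<le> F c}"
  define L where "L = {x \<in> dg lam. fst x = fst c \<and> snd x < snd c \<and>
     F x < F c \<and> enat (F c) < entry lam F (down x)}"
  define G where "G = {x \<in> dg lam. fst x = fst c \<and> snd c < snd x \<and>
     F x < F c \<and> enat (F c) < entry lam F (down x)}"
  have finite_parts: "finite L" "finite G" "finite Y"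
    using fin by (simp_all add: L_def G_def Y_def)
  have upY: "up y \<in> dg lam \<and> fst (up y) = i \<and> F (up y) < F c \<and> down (up y) = y"
    if yY: "y \<in> Y" for y
  proof -
    obtain k where y: "y = (Suc i, k)" "(Suc i, k) \<in> dg lam" "F (Suc i, k) \<le> F c"
      using yY by (cases y) (auto simp: Y_def)
    have "(i, k) \<in> dg lam"
      using dg_upward_closed[OF part y(2) i] .
    moreover have "F (i, k) < F (Suc i, k)"
      using CSF_less[OF F calculation y(2)] .
    ultimately show ?thesis
      using y by (simp add: up_def down_def)
  qed
  have "card (up ` Y) = card Y"
    using upY by (intro card_image inj_onI) metis
  have "{u \<in> dg lam. fst u = i \<and> F u \<le> F c - 1} = (L \<union> G) \<union> up ` Y"
  proof (intro equalityI subsetI)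
    fix x assume "x \<in> {u \<in> dg lam. fst u = i \<and> F u \<le> F c - 1}"
    \<comment> \<open>Entries are at least 1, so being at most \<open>F c - 1\<close> means being
      less than \<open>F c\<close>.\<close>
    then have x: "x \<in> dg lam" "fst x = i" "F x < F c"
      using CSF_range[OF F c] by auto
    then have "snd x \<noteq> snd c"
      using i_def prod_eqI by blast
    show "x \<in> (L \<union> G) \<union> up ` Y"
    proof (cases "down x \<in> Y")
      case True
      moreover have "x = up (down x)"
        by (simp add: up_def down_def)
      ultimately show ?thesis
        by blast
    next
      case False
      then show ?thesis
        using x \<open>snd x \<noteq> snd c\<close>
        by (auto simp: L_def G_def Y_def i_def enat_less_entry_iff down_def)
    qed
  next
    fix x assume "x \<in> (L \<union> G) \<union> up ` Y"
    then have "x \<in> dg lam \<and> fst x = i \<and> F x < F c"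
      using upY by (auto simp: L_def G_def i_def)
    then show "x \<in> {u \<in> dg lam. fst u = i \<and> F u \<le> F c - 1}"
      by auto
  qed
  moreover have "(L \<union> G) \<inter> up ` Y = {}"
    using upY by (auto simp: L_def G_def Y_def enat_less_entry_iff)
  moreover have "L \<inter> G = {}"
    by (auto simp: L_def G_def)
  ultimately have "row_count lam F i (F c - 1) = card L + card G + card Y"
    using finite_parts \<open>card (up ` Y) = card Y\<close> by (simp add: row_count_def card_Un_disjoint)
  then show ?thesis
    by (simp add: zcount_def zcount_bar_def row_count_def L_def G_def Y_def i_def)
qed

text \<open>The sum depends only on the row, the entry and the row counts, and the row counts can be
  read off from \<open>rsort\<close>.\<close>

lemma zcount_add_zcount_bar_cong:
  assumes "is_partition lam" and "F \<in> CSF n lam" and "F' \<in> CSF n lam"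
    and "rsort lam F = rsort lam F'"
    and "c \<in> dg lam" and "c' \<in> dg lam" and "fst c = fst c'" and "F c = F' c'"
  shows "zcount lam c F + zcount_bar lam c F = zcount lam c' F' + zcount_bar lam c' F'"
proof -
  have "row_count lam F i k = row_count lam F' i k" for i k
    using assms(4) row_count_rsort by metis
  then show ?thesis
    using zcount_add_zcount_bar[OF assms(1,2,5)] zcount_add_zcount_bar[OF assms(1,3,6)] assms(7,8)
    by simp
qed


subsection \<open>Partition overlaid patterns\<close>

lemma is_partition_partition_of_list:
  assumes "sorted_wrt (\<ge>) xs"
  shows "is_partition (partition_of_list xs)"
proof -
  have "partition_of_list xs j \<le> partition_of_list xs i" if "1 \<le> i" "i \<le> j" for i j
    using that sorted_wrt_nth_less[OF assms, of "i - 1" "j - 1"]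
    by (cases "i = j") (auto simp: partition_of_list_def)
  moreover have "{i. partition_of_list xs i \<noteq> 0} \<subseteq> {1..length xs}"
    by (auto simp: partition_of_list_def)
  then have "finite {i. partition_of_list xs i \<noteq> 0}"
    by (rule finite_subset) simp
  ultimately show ?thesis
    by (simp add: is_partition_def partition_of_list_def)
qed

text \<open>Only an inequality, since zeros in the list are not parts.\<close>

lemma num_parts_partition_of_list: "num_parts (partition_of_list xs) \<le> length xs"
proof -
  have "{i. partition_of_list xs i \<noteq> 0} \<subseteq> {1..length xs}"
    by (auto simp: partition_of_list_def)
  then show ?thesis
    using card_mono[of "{1..length xs}"] by (fastforce simp: num_parts_def)
qed

lemma pattern_of_rsort:
  "pattern_of n lam (rsort lam F) j i =
     (if 1 \<le> i \<and> i \<le> j \<and> j \<le> n then int (row_count lam F i j) else 0)"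
  using row_count_rsort[of lam F i j] by (simp add: pattern_of_def row_count_def)

lemma row_count_Suc:
  assumes "is_partition lam"
  shows "row_count lam F i (j + 1) = row_count lam F i j + card (cells lam i j F)"
proof -
  have "{u \<in> dg lam. fst u = i \<and> F u \<le> j + 1} = {u \<in> dg lam. fst u = i \<and> F u \<le> j} \<union> cells lam i j F"
    by (auto simp: cells_def)
  moreover have "{u \<in> dg lam. fst u = i \<and> F u \<le> j} \<inter> cells lam i j F = {}"
    by (auto simp: cells_def)
  ultimately show ?thesis
    using finite_dg[OF assms] by (simp add: row_count_def card_Un_disjoint cells_def)
qed

lemma NE_pattern_of_rsort:
  assumes "is_partition lam" and "1 \<le> i" and "i \<le> j" and "j < n"
  shows "NE (pattern_of n lam (rsort lam F)) i j = int (card (cells lam i j F))"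
  using assms row_count_Suc[OF assms(1), of F i j] by (simp add: NE_def pattern_of_rsort)

text \<open>By column strictness \<open>up\<close> injects the cells counted on the left into those
  counted on the right. This is nonnegativity of \<open>SE\<close>.\<close>

lemma row_count_down_le:
  assumes part: "is_partition lam" and F: "F \<in> CSF n lam" and i: "1 \<le> i"
  shows "row_count lam F (i + 1) (j + 1) \<le> row_count lam F i j"
  unfolding row_count_def
proof (rule card_inj_on_le)
  show "inj_on up {u \<in> dg lam. fst u = i + 1 \<and> F u \<le> j + 1}"
    by (auto simp: inj_on_def up_def intro: prod_eqI)
  show "finite {u \<in> dg lam. fst u = i \<and> F u \<le> j}"
    using finite_dg[OF part] by simp
  show "up ` {u \<in> dg lam. fst u = i + 1 \<and> F u \<le> j + 1} \<subseteq> {u \<in> dg lam. fst u = i \<and> F u \<le> j}"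
  proof clarsimp
    fix k assume "(Suc i, k) \<in> dg lam" "F (Suc i, k) \<le> Suc j"
    then show "up (Suc i, k) \<in> dg lam \<and> fst (up (Suc i, k)) = i \<and> F (up (Suc i, k)) \<le> j"
      using dg_upward_closed[OF part, of i k] CSF_less[OF F, of i k] i by (simp add: up_def)
  qed
qed

lemma pattern_of_rsort_GT:
  assumes part: "is_partition lam" and F: "F \<in> CSF n lam"
  shows "pattern_of n lam (rsort lam F) \<in> GT n lam"
proof -
  \<comment> \<open>All entries are at most \<open>n\<close>, so the top row of the pattern records
    the row lengths.\<close>
  have "row_count lam F i n = lam i" if "1 \<le> i" for i
  proof -
    have "F (i, l) \<le> n" if "l \<in> set [1..<lam i + 1]" for l
      using that \<open>1 \<le> i\<close> CSF_range[OF F, of "(i, l)"]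
      by (simp add: dg_def del: upt_Suc)
    then have "filter (\<lambda>v. v \<le> n) (row_list lam F i) = row_list lam F i"
      by (intro filter_True) (auto simp del: upt_Suc)
    then show ?thesis
      by (simp add: row_count_row_list[OF that])
  qed
  moreover have "SE (pattern_of n lam (rsort lam F)) i j \<ge> 0" if "1 \<le> i" "i \<le> j" "j < n" for i j
    using that row_count_down_le[OF part F that(1), of j] by (simp add: SE_def pattern_of_rsort)
  moreover have "NE (pattern_of n lam (rsort lam F)) i j \<ge> 0" if "1 \<le> i" "i \<le> j" "j < n" for i j
    using that by (simp add: NE_pattern_of_rsort[OF part])
  ultimately show ?thesis
    by (simp add: GT_def pattern_of_rsort)
qed

text \<open>Cells labelled \<open>j\<close> carry the entry \<open>j + 1\<close>, so the row counts
  in the sum formula are the two pattern entries in \<open>SE\<close>. Each zcount is thus bounded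
  by \<open>SE\<close>, for both overlays.\<close>

lemma zcount_add_zcount_bar_eq_SE:
  assumes part: "is_partition lam" and F: "F \<in> CSF n lam"
    and ij: "1 \<le> i" "i \<le> j" "j < n" and c: "c \<in> cells lam i j F"
  shows "int (zcount lam c F + zcount_bar lam c F) = SE (pattern_of n lam (rsort lam F)) i j"
proof -
  have "c \<in> dg lam" "fst c = i" "F c = j + 1"
    using c by (auto simp: cells_def)
  then show ?thesis
    using zcount_add_zcount_bar[OF part F, of c] ij by (simp add: SE_def pattern_of_rsort)
qed

text \<open>Shared by both maps psi, with \<open>xs i j\<close> the sequence of zcounts in the
  chosen reading order.\<close>

lemma overlay_mem_POP:
  assumes part: "is_partition lam" and F: "F \<in> CSF n lam"
    and len: "\<And>i j. 1 \<le> i \<Longrightarrow> i \<le> j \<Longrightarrow> j < n \<Longrightarrow> length (xs i j) \<le> card (cells lam i j F)"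
    and dec: "\<And>i j. 1 \<le> i \<Longrightarrow> i \<le> j \<Longrightarrow> j < n \<Longrightarrow> sorted_wrt (\<ge>) (xs i j)"
    and bound: "\<And>i j x. 1 \<le> i \<Longrightarrow> i \<le> j \<Longrightarrow> j < n \<Longrightarrow> x \<in> set (xs i j) \<Longrightarrow>
      int x \<le> SE (pattern_of n lam (rsort lam F)) i j"
  shows "(pattern_of n lam (rsort lam F),
      \<lambda>i j. if 1 \<le> i \<and> i \<le> j \<and> j < n then partition_of_list (xs i j) else (\<lambda>_. 0)) \<in> POP n lam"
proof -
  have GT: "pattern_of n lam (rsort lam F) \<in> GT n lam"
    by (rule pattern_of_rsort_GT[OF part F])
  have "is_partition (partition_of_list (xs i j)) \<and>
      int (num_parts (partition_of_list (xs i j))) \<le> NE (pattern_of n lam (rsort lam F)) i j \<and>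
      (\<forall>m. int (partition_of_list (xs i j) m) \<le> SE (pattern_of n lam (rsort lam F)) i j)"
    if ij: "1 \<le> i" "i \<le> j" "j < n" for i j
  proof (intro conjI allI)
    show "is_partition (partition_of_list (xs i j))"
      by (rule is_partition_partition_of_list[OF dec[OF ij]])
    show "int (num_parts (partition_of_list (xs i j))) \<le> NE (pattern_of n lam (rsort lam F)) i j"
      using num_parts_partition_of_list[of "xs i j"] len[OF ij]
      by (simp add: NE_pattern_of_rsort[OF part ij])
    \<comment> \<open>Beyond the list the part is 0, and the bound then follows from nonnegativity
      of \<open>SE\<close> in a pattern.\<close>
    show "int (partition_of_list (xs i j) m) \<le> SE (pattern_of n lam (rsort lam F)) i j" for m
      using bound[OF ij, of "xs i j ! (m - 1)"] GT ij by (auto simp: partition_of_list_def GT_def)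
  qed
  then show ?thesis
    using GT by (simp add: POP_def)
qed

lemma cells_left_to_right_props:
  assumes "is_partition lam"
  shows set_cells_left_to_right: "set (cells_left_to_right lam i j F) = cells lam i j F"
    and distinct_cells_left_to_right: "distinct (cells_left_to_right lam i j F)"
    and length_cells_left_to_right: "length (cells_left_to_right lam i j F) = card (cells lam i j F)"
    and sorted_cells_left_to_right:
      "sorted_wrt (\<lambda>c d. snd c < snd d) (cells_left_to_right lam i j F)"
proof -
  have fin: "finite (snd ` cells lam i j F)"
    using finite_dg[OF assms] by (simp add: cells_def)
  have "Pair i ` snd ` cells lam i j F = cells lam i j F"
    by (auto simp: cells_def image_iff)
  then show set: "set (cells_left_to_right lam i j F) = cells lam i j F"
    using fin by (simp add: cells_left_to_right_def)
  show distinct: "distinct (cells_left_to_right lam i j F)"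
    by (simp add: cells_left_to_right_def distinct_map inj_on_def)
  show "length (cells_left_to_right lam i j F) = card (cells lam i j F)"
    using distinct_card[OF distinct] set by simp
  show "sorted_wrt (\<lambda>c d. snd c < snd d) (cells_left_to_right lam i j F)"
    by (simp add: cells_left_to_right_def sorted_wrt_map)
qed

text \<open>With row and entry fixed, moving the cell right only admits more candidates
  \<open>x\<close> to its left.\<close>

lemma zcount_mono:
  assumes "is_partition lam" and "fst c = fst d" and "F c = F d" and "snd c \<le> snd d"
  shows "zcount lam c F \<le> zcount lam d F"
  unfolding zcount_def using assms finite_dg[OF assms(1)] by (intro card_mono) auto

lemma zcount_bar_antimono:
  assumes "is_partition lam" and "fst c = fst d" and "F c = F d" and "snd c \<le> snd d"
  shows "zcount_bar lam d F \<le> zcount_bar lam c F"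
  unfolding zcount_bar_def using assms finite_dg[OF assms(1)] by (intro card_mono) auto

lemma psi_quinv_POP:
  assumes part: "is_partition lam" and F: "F \<in> CSF n lam"
  shows "psi_quinv n lam F \<in> POP n lam"
  unfolding psi_quinv_def
proof (rule overlay_mem_POP[OF part F])
  fix i j assume ij: "1 \<le> i" "i \<le> j" "j < n"
  let ?cs = "cells_left_to_right lam i j F"
  note cs = cells_left_to_right_props[OF part, of i j F]
  show "length (map (\<lambda>c. zcount lam c F) (rev ?cs)) \<le> card (cells lam i j F)"
    by (simp add: cs)
  show "sorted_wrt (\<ge>) (map (\<lambda>c. zcount lam c F) (rev ?cs))"
    \<comment> \<open>Decreasing from right to left means increasing from left to right, which is
      what \<open>zcount_mono\<close> supplies.\<close>
    unfolding sorted_wrt_map sorted_wrt_rev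
    by (rule sorted_wrt_mono_rel[OF _ cs(4)])
      (auto simp: cs cells_def intro!: zcount_mono[OF part])
  show "int x \<le> SE (pattern_of n lam (rsort lam F)) i j"
    if x: "x \<in> set (map (\<lambda>c. zcount lam c F) (rev ?cs))" for x
  proof -
    obtain c where "c \<in> cells lam i j F" "x = zcount lam c F"
      using x by (auto simp: cs)
    then show ?thesis
      using zcount_add_zcount_bar_eq_SE[OF part F ij, of c] by simp
  qed
qed

lemma psi_inv_POP:
  assumes part: "is_partition lam" and F: "F \<in> CSF n lam"
  shows "psi_inv n lam F \<in> POP n lam"
  unfolding psi_inv_def
proof (rule overlay_mem_POP[OF part F])
  fix i j assume ij: "1 \<le> i" "i \<le> j" "j < n"
  let ?cs = "cells_left_to_right lam i j F"
  note cs = cells_left_to_right_props[OF part, of i j F]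
  show "length (map (\<lambda>c. zcount_bar lam c F) ?cs) \<le> card (cells lam i j F)"
    by (simp add: cs)
  show "sorted_wrt (\<ge>) (map (\<lambda>c. zcount_bar lam c F) ?cs)"
    unfolding sorted_wrt_map
    by (rule sorted_wrt_mono_rel[OF _ cs(4)])
      (auto simp: cs cells_def intro!: zcount_bar_antimono[OF part])
  show "int x \<le> SE (pattern_of n lam (rsort lam F)) i j"
    if x: "x \<in> set (map (\<lambda>c. zcount_bar lam c F) ?cs)" for x
  proof -
    obtain c where "c \<in> cells lam i j F" "x = zcount_bar lam c F"
      using x by (auto simp: cs)
    then show ?thesis
      using zcount_add_zcount_bar_eq_SE[OF part F ij, of c] by simp
  qed
qed


subsection \<open>Chari-Loktev monomials\<close>

lemma sorted_concat_keyed: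
  assumes "sorted js" and "\<And>j x. j \<in> set js \<Longrightarrow> x \<in> set (h j) \<Longrightarrow> f x = key j" and "mono key"
  shows "sorted (map f (concat (map h js)))"
  using assms(1,2)
proof (induction js)
  case (Cons j js)
  have "sorted (map f (h j))"
    using Cons.prems(2)[of j] by (simp add: sorted_iff_nth_mono)
  moreover have "f x \<le> f y" if "x \<in> set (h j)" "i \<in> set js" "y \<in> set (h i)" for x y i
    using Cons.prems(1) Cons.prems(2)[of j x] Cons.prems(2)[of i y] that monoD[OF assms(3), of j i]
    by simp
  ultimately show ?case
    using Cons by (auto simp: sorted_append)
qed simp

text \<open>Distinct keys keep the lists disjoint. The key is the row within one value of
  \<open>j\<close>, and the entry across different values of \<open>j\<close>.\<close>

lemma distinct_concat_keyed:
  assumes "distinct js" and "\<And>j. j \<in> set js \<Longrightarrow> distinct (h j)"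
    and "\<And>j x. j \<in> set js \<Longrightarrow> x \<in> set (h j) \<Longrightarrow> f x = key j" and "inj key"
  shows "distinct (concat (map h js))"
  using assms(1,2,3)
proof (induction js)
  case (Cons j js)
  have "x \<notin> set (h i)" if "x \<in> set (h j)" "i \<in> set js" for x i
  proof
    assume "x \<in> set (h i)"
    then have "key j = key i"
      using Cons.prems(3)[of j x] Cons.prems(3)[of i x] that by simp
    then show False
      using injD[OF assms(4)] Cons.prems(1) that(2) by (metis distinct.simps(2))
  qed
  moreover have "distinct (concat (map h js))"
    using Cons.prems by (intro Cons.IH) simp_all
  ultimately show ?case
    using Cons.prems(2)[of j] by auto
qed simp

text \<open>The nested products flatten to one enumeration, by entry and then by row; any other
  weakly increasing enumeration only permutes commuting factors. Abstract \<open>z\<close> and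
  \<open>l\<close> cover both zcounts with their reading orders.\<close>

lemma CL_eq_list_prod:
  fixes z :: "cell \<Rightarrow> nat"
  assumes part: "is_partition lam" and F: "F \<in> CSF n lam"
    and set_l: "\<And>i j. 1 \<le> i \<Longrightarrow> i \<le> j \<Longrightarrow> j < n \<Longrightarrow> set (l i j) = cells lam i j F"
    and distinct_l: "\<And>i j. 1 \<le> i \<Longrightarrow> i \<le> j \<Longrightarrow> j < n \<Longrightarrow> distinct (l i j)"
    and fst_P: "fst P = pattern_of n lam (rsort lam F)"
    and snd_P: "\<And>i j. 1 \<le> i \<Longrightarrow> i \<le> j \<Longrightarrow> j < n \<Longrightarrow> snd P i j = partition_of_list (map z (l i j))"
    and cs: "weakly_increasing_enumeration lam F cs"
  shows "CL n P = list_prod (U_nminus n) (map (\<lambda>c. Et n (F c) (fst c) (z c)) cs)"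
proof -
  interpret U: ring "U_nminus n"
    by (rule U_nminus_ring)
  define g where "g = (\<lambda>c. Et n (F c) (fst c) (z c))"
  define block where "block j = concat (map (\<lambda>i. l i j) [1..<j + 1])" for j
  define all_cells where "all_cells = concat (map block [1..<n])"
  \<comment> \<open>There are \<open>NE\<close> factors, one per cell of \<open>l i j\<close>, so
    zero parts are included; the parts are indexed from 1 and the list from 0.\<close>
  have CL_ij: "CL_ij n P i j = list_prod (U_nminus n) (map g (l i j))"
    if ij: "1 \<le> i" "i \<le> j" "j < n" for i j
  proof -
    have "nat (NE (fst P) i j) = length (l i j)"
      using NE_pattern_of_rsort[OF part ij, of F] distinct_card[OF distinct_l[OF ij]] set_l[OF ij]
      by (simp add: fst_P)
    moreover have "map (\<lambda>m. Et n (j + 1) i (snd P i j m)) [1..<length (l i j) + 1] = map g (l i j)"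
    proof (rule nth_equalityI)
      fix k assume "k < length (map (\<lambda>m. Et n (j + 1) i (snd P i j m)) [1..<length (l i j) + 1])"
      then have k: "k < length (l i j)"
        by (simp del: upt_Suc)
      then have "l i j ! k \<in> cells lam i j F"
        using set_l[OF ij] nth_mem by blast
      then show "map (\<lambda>m. Et n (j + 1) i (snd P i j m)) [1..<length (l i j) + 1] ! k = map g (l i j) ! k"
        using k by (simp add: snd_P[OF ij] g_def partition_of_list_def cells_def del: upt_Suc)
    qed (simp del: upt_Suc)
    ultimately show ?thesis
      by (simp only: CL_ij_def)
  qed
  have g_closed: "g c \<in> carrier (U_nminus n)" if "fst c < F c" for c
    using that by (simp add: g_def Et_closed)
  \<comment> \<open>Row at most \<open>j\<close> with entry \<open>j + 1\<close> says that the entry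
    exceeds the row number, so each factor comes from a strictly lower triangular matrix.\<close>
  have set_block: "set (block j) = {c \<in> dg lam. fst c \<le> j \<and> F c = j + 1}" if "1 \<le> j" "j < n" for j
    using that set_l[of _ j] by (auto simp: block_def cells_def dg_def simp del: upt_Suc)
  have CL_j: "CL_j n P j = list_prod (U_nminus n) (map g (block j))" if j: "1 \<le> j" "j < n" for j
  proof -
    have "CL_j n P j = list_prod (U_nminus n)
        (map (list_prod (U_nminus n)) (map (\<lambda>i. map g (l i j)) [1..<j + 1]))"
      unfolding CL_j_def using j
      by (intro arg_cong[where f = "list_prod _"]) (auto simp: CL_ij simp del: upt_Suc)
    also have "\<dots> = list_prod (U_nminus n) (concat (map (\<lambda>i. map g (l i j)) [1..<j + 1]))"
      using j set_l[of _ j]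
      by (intro U.list_prod_concat[symmetric]) (auto simp: cells_def intro!: g_closed simp del: upt_Suc)
    finally show ?thesis
      by (simp add: block_def map_concat comp_def del: upt_Suc)
  qed
  have "CL n P = list_prod (U_nminus n)
      (map (list_prod (U_nminus n)) (map (\<lambda>j. map g (block j)) [1..<n]))"
    unfolding CL_def by (intro arg_cong[where f = "list_prod _"]) (auto simp: CL_j)
  also have "\<dots> = list_prod (U_nminus n) (concat (map (\<lambda>j. map g (block j)) [1..<n]))"
    by (intro U.list_prod_concat[symmetric]) (auto simp: set_block intro!: g_closed)
  also have "\<dots> = list_prod (U_nminus n) (map g all_cells)"
    by (simp add: all_cells_def map_concat comp_def)
  also have "\<dots> = list_prod (U_nminus n) (map g cs)"
  proof (rule U.list_prod_eq_of_sorted[where f = F])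
    have set_all: "set all_cells = {c \<in> dg lam. fst c < F c}"
    proof (intro equalityI subsetI)
      \<comment> \<open>Rows start at 1, so the entry lies between 2 and \<open>n\<close> and the
        cell belongs to the block of index \<open>F c - 1\<close>.\<close>
      fix c assume "c \<in> {c \<in> dg lam. fst c < F c}"
      then have "c \<in> dg lam" "fst c < F c" "F c \<le> n" "1 \<le> fst c"
        using CSF_range[OF F] by (auto simp: dg_def)
      then have "c \<in> set (block (F c - 1))" "F c - 1 \<in> set [1..<n]"
        by (auto simp: set_block)
      then show "c \<in> set all_cells"
        unfolding all_cells_def by auto
    qed (auto simp: all_cells_def set_block)
    have "distinct (block j)" if "j \<in> set [1..<n]" for j
      unfolding block_def using that
      by (intro distinct_concat_keyed[where f = fst and key = id])
        (auto simp: distinct_l set_l cells_def simp del: upt_Suc)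
    then have "distinct all_cells"
      unfolding all_cells_def
      by (rule distinct_concat_keyed[where f = F and key = Suc, rotated]) (auto simp: set_block)
    then show "mset all_cells = mset cs"
      using cs set_all unfolding weakly_increasing_enumeration_def
      by (metis set_eq_iff_mset_eq_distinct)
    show "sorted (map F all_cells)"
      unfolding all_cells_def
      by (rule sorted_concat_keyed[where key = Suc]) (auto simp: set_block mono_def)
    show "sorted (map F cs)"
      using cs by (simp add: weakly_increasing_enumeration_def)
    show "g c \<in> carrier (U_nminus n)" if "c \<in> set all_cells" for c
      using that set_all by (auto intro: g_closed)
    show "g c \<otimes>\<^bsub>U_nminus n\<^esub> g d = g d \<otimes>\<^bsub>U_nminus n\<^esub> g c"
      if "c \<in> set all_cells" "d \<in> set all_cells" "F c = F d" for c d
    proof -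
      have "fst c < F c" "fst d < F c"
        using that set_all by auto
      then show ?thesis
        using that(3) by (simp add: g_def Et_commute)
    qed
  qed
  finally show ?thesis
    by (simp add: g_def)
qed

text \<open>The sum in the second claim is a function of row and entry, not of position: for one-row
  fillings \<open>1 2\<close> and \<open>2 1\<close> the first cell has sum 0 and 1. Hence cells
  \<open>c\<close> and \<open>c'\<close> of one row with equal entries are compared. Quantifying
  over \<open>cs\<close> in the third claim expresses independence of the enumeration.\<close>

theorem proposition2:
  fixes n :: nat and lam :: "nat \<Rightarrow> nat"
  assumes "n \<ge> 1" and "is_partition lam" and "num_parts lam \<le> n"
  shows
    "(\<forall>F \<in> CSF n lam.
        (\<Sum>c\<in>dg lam. int (zcount lam c F)) = quinv_stat lam F \<and>
        (\<Sum>c\<in>dg lam. int (zcount_bar lam c F)) = inv_stat lam F)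
     \<and>
     (\<forall>F \<in> CSF n lam. \<forall>F' \<in> CSF n lam. rsort lam F = rsort lam F' \<longrightarrow>
        (\<forall>c \<in> dg lam. \<forall>c' \<in> dg lam. fst c = fst c' \<and> F c = F' c' \<longrightarrow>
           zcount lam c F + zcount_bar lam c F = zcount lam c' F' + zcount_bar lam c' F'))
     \<and>
     (\<forall>F \<in> CSF n lam.
        psi_quinv n lam F \<in> POP n lam \<and> psi_inv n lam F \<in> POP n lam \<and>
        (\<forall>cs. weakly_increasing_enumeration lam F cs \<longrightarrow>
           CL n (psi_quinv n lam F)
             = list_prod (U_nminus n) (map (\<lambda>c. Et n (F c) (fst c) (zcount lam c F)) cs) \<and>
           CL n (psi_inv n lam F)
             = list_prod (U_nminus n) (map (\<lambda>c. Et n (F c) (fst c) (zcount_bar lam c F)) cs)))"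
proof (intro conjI ballI allI impI)
  note part = \<open>is_partition lam\<close>
  fix F assume F: "F \<in> CSF n lam"
  note cells_props = set_cells_left_to_right[OF part] distinct_cells_left_to_right[OF part]
  show "(\<Sum>c\<in>dg lam. int (zcount lam c F)) = quinv_stat lam F"
    by (rule sum_zcount[OF part F])
  show "(\<Sum>c\<in>dg lam. int (zcount_bar lam c F)) = inv_stat lam F"
    by (rule sum_zcount_bar[OF part F])
  show "zcount lam c F + zcount_bar lam c F = zcount lam c' F' + zcount_bar lam c' F'"
    if "F' \<in> CSF n lam" "rsort lam F = rsort lam F'" "c \<in> dg lam" "c' \<in> dg lam"
      "fst c = fst c' \<and> F c = F' c'" for F' c c'
    using zcount_add_zcount_bar_cong[OF part F] that by blast
  show "psi_quinv n lam F \<in> POP n lam"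
    by (rule psi_quinv_POP[OF part F])
  show "psi_inv n lam F \<in> POP n lam"
    by (rule psi_inv_POP[OF part F])
  fix cs assume cs: "weakly_increasing_enumeration lam F cs"
  show "CL n (psi_quinv n lam F)
      = list_prod (U_nminus n) (map (\<lambda>c. Et n (F c) (fst c) (zcount lam c F)) cs)"
    by (rule CL_eq_list_prod[OF part F _ _ _ _ cs, where l = "\<lambda>i j. rev (cells_left_to_right lam i j F)"])
      (simp_all add: cells_props psi_quinv_def)
  show "CL n (psi_inv n lam F)
      = list_prod (U_nminus n) (map (\<lambda>c. Et n (F c) (fst c) (zcount_bar lam c F)) cs)"
    by (rule CL_eq_list_prod[OF part F _ _ _ _ cs, where l = "\<lambda>i j. cells_left_to_right lam i j F"])
      (simp_all add: cells_props psi_inv_def)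
qed

end
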